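(* For any packing of $n\geq 5$ horospheres in $\mathbb{H}^3$, the number $m$ of tangency points satisfies $$m\leq 5n-16.$$
   Context: A horosphere packing is a finite, connected set of distinct horospheres in hyperbolic space $\mathbb{H}^3$ (i.e. the union of the horospheres is connected) such that any two of the horospheres are either disjoint or tangent. Its number $m$ of tangency points is the number of unordered pairs of horospheres which are tangent. *)

theory Defs
  imports "HOL-Analysis.Analysis"
begin

text \<open>
  Hyperbolic 3-space is taken in the upper half-space model: the set of all points
  \<open>(z, t) :: complex \<times> real\<close> with \<open>t > 0\<close>. The product metric of \<open>complex \<times> real\<close> is
  the Euclidean metric of 3-space. The hyperbolic metric is conformal to it and
  induces the same topology, so connectedness and tangent vectors can be read off in
  \<open>complex \<times> real\<close>.
\<close>

definition upper_half_space :: "(complex \<times> real) set" where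
  "upper_half_space = {p. snd p > 0}"

text \<open>
  The horospheres are the horizontal planes (based at infinity) and the traces
  on the half-space of the Euclidean spheres lying above the boundary plane \<open>t = 0\<close> and
  tangent to it. The sphere of radius \<open>r\<close> tangent at \<open>(a, 0)\<close> has centre
  \<open>(a, r)\<close>; intersecting with the half-space removes exactly its base point \<open>(a, 0)\<close>.
\<close>

definition horosphere :: "(complex \<times> real) set \<Rightarrow> bool" where
  "horosphere S \<longleftrightarrow>
     (\<exists>c>0. S = {p \<in> upper_half_space. snd p = c}) \<or>
     (\<exists>a r. r > 0 \<and> S = sphere (a, r) r \<inter> upper_half_space)"

text \<open>Velocity vectors at \<open>p\<close> of curves in \<open>S\<close>; for a smooth surface \<open>S\<close> this
  is its tangent plane at \<open>p\<close>, as a linear subspace.\<close>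

definition tangent_vectors :: "'a::real_normed_vector set \<Rightarrow> 'a \<Rightarrow> 'a set" where
  "tangent_vectors S p = {v. \<exists>\<gamma>::real \<Rightarrow> 'a. \<gamma> 0 = p \<and> (\<forall>\<^sub>F s in nhds 0. \<gamma> s \<in> S) \<and>
     (\<gamma> has_vector_derivative v) (at 0)}"

text \<open>Every nonempty surface is tangent to itself in this sense; below, tangency is only
  used for distinct horospheres.\<close>

definition tangent :: "'a::real_normed_vector set \<Rightarrow> 'a set \<Rightarrow> bool" where
  "tangent S T \<longleftrightarrow> (\<exists>p \<in> S \<inter> T. tangent_vectors S p = tangent_vectors T p)"

definition horosphere_packing :: "(complex \<times> real) set set \<Rightarrow> bool" where
  "horosphere_packing P \<longleftrightarrow>
     finite P \<and> (\<forall>S\<in>P. horosphere S) \<and> connected (\<Union>P) \<and>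
     (\<forall>S\<in>P. \<forall>T\<in>P. S \<noteq> T \<longrightarrow> S \<inter> T = {} \<or> tangent S T)"

definition num_tangencies :: "(complex \<times> real) set set \<Rightarrow> nat" where
  "num_tangencies P = card {{S, T} | S T. S \<in> P \<and> T \<in> P \<and> S \<noteq> T \<and> tangent S T}"

end

theory Submission imports Defs begin

text \<open>
  After a generic isometry every horosphere is a Euclidean sphere touching the boundary plane,
  and two of them with base points \<open>a, b\<close> and diameters \<open>s\<^sup>2, t\<^sup>2\<close> are tangent iff
  \<open>\<bar>a - b\<bar> = s t\<close>. Moving a smallest sphere to infinity, its neighbours become unit-separated
  points in a punctured unit disc, so there are at most six of them, and at most five if the
  sphere is chosen leftmost among the smallest. Removing it reduces the claim
  to \<open>n = 5\<close>, where it says that five horospheres are not mutually tangent: otherwise, with one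
  of them at infinity, the other four would give four equidistant points in the plane.
\<close>

section \<open>Separated points in a disc\<close>

text \<open>Law of cosines: below 60 degrees the cosine exceeds 1/2, so the squared distance is less
  than x^2 + y^2 - x y, which is at most the larger of x^2 and y^2.\<close>

lemma norm_diff_less_of_close_Arg:
  fixes z w :: complex
  assumes "z \<noteq> 0" "w \<noteq> 0" "norm z \<le> \<rho>" "norm w \<le> \<rho>" and close: "\<bar>Arg z - Arg w\<bar> < pi / 3"
  shows "norm (z - w) < \<rho>"
proof -
  define x y c where "x = norm z" and "y = norm w" and "c = cos (Arg z - Arg w)"
  have pos: "x > 0" "y > 0" using assms by (auto simp: x_def y_def)
  have z: "z = of_real x * cis (Arg z)" and w: "w = of_real y * cis (Arg w)"
    using rcis_cmod_Arg[of z] rcis_cmod_Arg[of w] by (auto simp: x_def y_def rcis_def)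
  have "cos (pi / 3) < cos \<bar>Arg z - Arg w\<bar>"
    using close by (intro cos_monotone_0_pi) auto
  hence c: "c > 1 / 2" by (simp add: c_def cos_60)
  have sc: "(sin (Arg z))\<^sup>2 + (cos (Arg z))\<^sup>2 = 1" "(sin (Arg w))\<^sup>2 + (cos (Arg w))\<^sup>2 = 1" by simp_all
  have Re: "Re z = x * cos (Arg z)" "Im z = x * sin (Arg z)" "Re w = y * cos (Arg w)" "Im w = y * sin (Arg w)"
    by (subst z w, simp)+
  have "(norm (z - w))\<^sup>2 =
      x\<^sup>2 * ((sin (Arg z))\<^sup>2 + (cos (Arg z))\<^sup>2) + y\<^sup>2 * ((sin (Arg w))\<^sup>2 + (cos (Arg w))\<^sup>2) - 2 * (x * y) * c"
    unfolding cmod_power2 minus_complex.sel Re c_def cos_diff by algebra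
  also have "\<dots> = x\<^sup>2 + y\<^sup>2 - 2 * (x * y) * c" unfolding sc by simp
  also have "\<dots> < x\<^sup>2 + y\<^sup>2 - x * y"
    using mult_strict_left_mono[OF c, of "x * y"] pos by simp
  also have "\<dots> \<le> \<rho>\<^sup>2"
  proof (cases "x \<le> y")
    case True
    have "x\<^sup>2 \<le> x * y" using True pos by (simp add: power2_eq_square)
    moreover have "y\<^sup>2 \<le> \<rho>\<^sup>2" using assms pos by (intro power_mono) (auto simp: y_def)
    ultimately show ?thesis by simp
  next
    case False
    have "y\<^sup>2 \<le> x * y" using False pos by (simp add: power2_eq_square)
    moreover have "x\<^sup>2 \<le> \<rho>\<^sup>2" using assms pos by (intro power_mono) (auto simp: x_def)
    ultimately show ?thesis by simp
  qed
  finally show ?thesis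
    using assms(3) norm_ge_zero[of z] by (intro power_less_imp_less_base[of _ 2 \<rho>]) linarith+
qed

text \<open>Cuts the punctured plane into six half-open sectors of 60 degrees. Since
  \<open>Arg\<close> ranges over (-pi, pi], the values are -2, ..., 3, and each sector contains its
  upper boundary ray only.\<close>

definition sector :: "complex \<Rightarrow> int" where
  "sector z = \<lceil>3 * Arg z / pi\<rceil>"

lemma sector_bounds:
  "pi * (real_of_int (sector z) - 1) < 3 * Arg z" "3 * Arg z \<le> pi * real_of_int (sector z)"
proof -
  have "real_of_int (sector z) - 1 < 3 * Arg z / pi" "3 * Arg z / pi \<le> real_of_int (sector z)"
    unfolding sector_def by linarith+
  thus "pi * (real_of_int (sector z) - 1) < 3 * Arg z" "3 * Arg z \<le> pi * real_of_int (sector z)"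
    by (auto simp: field_simps)
qed

lemma sector_le_iff: "sector z \<le> k \<longleftrightarrow> 3 * Arg z \<le> pi * real_of_int k"
  unfolding sector_def by (simp add: ceiling_le_iff field_simps)

text \<open>Half-openness makes the angle between two points of one sector strictly less than 60
  degrees, so they would be closer than \<rho>.\<close>

lemma inj_on_sector:
  assumes "\<And>z. z \<in> B \<Longrightarrow> z \<noteq> 0 \<and> norm z \<le> \<rho>"
    and "\<And>z w. z \<in> B \<Longrightarrow> w \<in> B \<Longrightarrow> z \<noteq> w \<Longrightarrow> norm (z - w) \<ge> \<rho>"
  shows "inj_on sector B"
proof (rule inj_onI, rule ccontr)
  fix z w assume zw: "z \<in> B" "w \<in> B" "sector z = sector w" "z \<noteq> w"
  have "\<bar>Arg z - Arg w\<bar> < pi / 3"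
    using sector_bounds[of z] sector_bounds[of w] unfolding zw(3) right_diff_distrib by linarith
  hence "norm (z - w) < \<rho>"
    using assms(1) zw by (intro norm_diff_less_of_close_Arg) auto
  thus False using assms(2) zw by fastforce
qed

text \<open>Six sectors alone give only the bound six, attained by a regular hexagon on the boundary
  circle. The third hypothesis excludes it: a half-plane meets only four sectors, and a point inside
  the open disc keeps all others out of a wide angle around it.\<close>

lemma card_separated_in_disc_le_5:
  fixes B :: "complex set"
  assumes disc: "\<And>z. z \<in> B \<Longrightarrow> z \<noteq> 0 \<and> norm z \<le> \<rho>"
    and sep: "\<And>z w. z \<in> B \<Longrightarrow> w \<in> B \<Longrightarrow> z \<noteq> w \<Longrightarrow> norm (z - w) \<ge> \<rho>"
    and "(\<exists>z\<in>B. norm z < \<rho>) \<or> (\<forall>z\<in>B. Re z \<ge> 0)"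
  shows "card B \<le> 5"
  using assms(3)
proof
  assume "\<forall>z\<in>B. Re z \<ge> 0"
  have "sector ` B \<subseteq> {-1..2}"
  proof (rule image_subsetI)
    fix z assume z: "z \<in> B"
    hence "\<bar>Arg z\<bar> \<le> pi / 2"
      using \<open>\<forall>z\<in>B. Re z \<ge> 0\<close> disc Arg_Re_nonneg[of z] by auto
    moreover have "\<not> sector z \<le> - 2" using calculation pi_gt_zero unfolding sector_le_iff of_int_neg_numeral by linarith
    moreover have "sector z \<le> 2" using calculation(1) pi_gt_zero unfolding sector_le_iff of_int_numeral by linarith
    ultimately show "sector z \<in> {-1..2}" by auto
  qed
  moreover have "inj_on sector B" by (rule inj_on_sector[OF disc sep])
  ultimately have "card B \<le> card {-1..2::int}" by (intro card_inj_on_le) auto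
  thus ?thesis by simp
next
  text \<open>All other points make an angle of more than 60 degrees with a point \<open>b\<close>
    of the open disc, so after rotating \<open>b\<close> to the positive axis only four sectors remain.\<close>
  assume "\<exists>z\<in>B. norm z < \<rho>"
  then obtain b where b: "b \<in> B" "norm b < \<rho>" by blast
  \<comment> \<open>Division by \<open>b\<close> moves \<open>b\<close> to 1 and turns both the
    radius and the separation into \<open>\<sigma>\<close>; that \<open>b\<close> lies in the open
    disc becomes \<open>\<sigma> > 1\<close>.\<close>
  define C where "C = (\<lambda>z. z / b) ` (B - {b})"
  define \<sigma> where "\<sigma> = \<rho> / norm b"
  have b0: "b \<noteq> 0" using disc b by auto
  have \<sigma>: "\<sigma> > 1" using b b0 by (simp add: \<sigma>_def)
  have card: "card C = card (B - {b})"
    unfolding C_def by (intro card_image inj_onI) (use b0 in auto)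
  have C: "w \<noteq> 0 \<and> norm w \<le> \<sigma> \<and> norm (w - 1) \<ge> \<sigma>" if w: "w \<in> C" for w
  proof -
    obtain z where z: "z \<in> B" "z \<noteq> b" "w = z / b" using w by (auto simp: C_def)
    have "w - 1 = (z - b) / b" using z b0 by (simp add: field_simps)
    thus ?thesis using disc[OF z(1)] sep[OF z(1) b(1) z(2)] z b0
      by (auto simp: \<sigma>_def norm_divide divide_right_mono)
  qed
  have "norm (w - w') \<ge> \<sigma>" if ww: "w \<in> C" "w' \<in> C" "w \<noteq> w'" for w w'
  proof -
    obtain z z' where z: "z \<in> B" "w = z / b" "z' \<in> B" "w' = z' / b" using ww by (auto simp: C_def)
    hence "norm (z - z') \<ge> \<rho>" using sep ww by auto
    thus ?thesis using z by (simp add: \<sigma>_def norm_divide divide_right_mono flip: diff_divide_distrib)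
  qed
  hence inj: "inj_on sector C" by (intro inj_on_sector[of C \<sigma>]) (use C in auto)
  have "sector ` C \<subseteq> {-2,-1,2,3}"
  proof (rule image_subsetI)
    fix w assume w: "w \<in> C"
    have "\<bar>Arg w\<bar> \<ge> pi / 3"
      using norm_diff_less_of_close_Arg[of w 1 \<sigma>] C[OF w] \<sigma> by (force simp: Arg_of_real)
    \<comment> \<open>The ray at angle pi/3 belongs to sector 1, so it has to be excluded
      separately. On it the squared distance to 1 is |w|^2 - |w| + 1, which is below \<sigma>^2
      because |w| \<le> \<sigma> and \<sigma> > 1.\<close>
    moreover have "\<bar>Arg w\<bar> \<noteq> pi / 3"
    proof
      assume A: "\<bar>Arg w\<bar> = pi / 3"
      have w0: "norm w > 0" using C[OF w] by auto
      have "cos \<bar>Arg w\<bar> = 1 / 2" by (simp only: A cos_60)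
      hence "Re w = norm w / 2" using C[OF w] cos_Arg[of w] w0 by (simp add: field_simps)
      have "(norm (w - 1))\<^sup>2 = (norm w)\<^sup>2 - 2 * Re w + 1"
        by (simp add: cmod_power2) (simp add: power2_eq_square algebra_simps)
      also have "\<dots> < \<sigma>\<^sup>2"
      proof (cases "norm w < 1")
        case True
        have "(norm w)\<^sup>2 < norm w" using True w0 by (simp add: power2_eq_square)
        moreover have "1 < \<sigma>\<^sup>2" using \<sigma> by (simp add: one_less_power)
        ultimately show ?thesis using \<open>Re w = _\<close> by simp
      next
        case False
        show ?thesis
        proof (cases "norm w = 1")
          case True
          moreover have "1 < \<sigma>\<^sup>2" using \<sigma> by (simp add: one_less_power)
          ultimately show ?thesis using \<open>Re w = _\<close> by simp
        next
          case F: False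
          have "(norm w)\<^sup>2 \<le> \<sigma>\<^sup>2" using C[OF w] by (intro power_mono) auto
          thus ?thesis using \<open>Re w = _\<close> False F by simp
        qed
      qed
      finally show False
        using C[OF w] \<sigma> by (auto dest!: power_less_imp_less_base)
    qed
    ultimately have A: "\<bar>Arg w\<bar> > pi / 3" by simp
    have "\<not> sector w \<le> -3" "sector w \<le> 3"
      using Arg_bounded[of w] by (auto simp: sector_le_iff)
    moreover have "\<not> (-1 < sector w \<and> sector w \<le> 1)"
    proof
      assume "-1 < sector w \<and> sector w \<le> 1"
      hence "\<not> sector w \<le> -1" "sector w \<le> 1" by auto
      thus False using A by (simp add: sector_le_iff abs_if split: if_splits)
    qed
    ultimately show "sector w \<in> {-2,-1,2,3}" by auto
  qed
  hence "card C \<le> card {-2,-1,2,3::int}" using inj by (intro card_inj_on_le) auto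
  hence "card (B - {b}) \<le> 4" by (simp add: card)
  moreover have "card B \<le> card (B - {b}) + 1" using b by (simp add: card_Diff_singleton)
  ultimately show ?thesis by linarith
qed

text \<open>Normalise two of the points to 0 and 1. The other two then have real part 1/2 and
  squared imaginary part 3/4, while their mutual distance 1 forces the product of the imaginary
  parts to be 1/4 instead of 3/4 in absolute value.\<close>

lemma card_equidistant_neq_4:
  fixes B :: "complex set"
  assumes "\<rho> > 0" and eq: "\<And>z w. z \<in> B \<Longrightarrow> w \<in> B \<Longrightarrow> z \<noteq> w \<Longrightarrow> norm (z - w) = \<rho>"
  shows "card B \<noteq> 4"
proof
  assume "card B = 4"
  then obtain a b c d where B: "B = {a,b,c,d}" "distinct [a,b,c,d]"
    by (auto simp: card_Suc_eq numeral_eq_Suc)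
  define p q where "p = (c - a) / (b - a)" and "q = (d - a) / (b - a)"
  have ba: "norm (b - a) = \<rho>" "b - a \<noteq> 0" using eq B by auto
  have "p - 1 = (c - b) / (b - a)" "q - 1 = (d - b) / (b - a)" "p - q = (c - d) / (b - a)"
    using ba(2) by (simp_all add: p_def q_def divide_simps)
  hence "norm p = 1" "norm q = 1" "norm (p - 1) = 1" "norm (q - 1) = 1" "norm (p - q) = 1"
    using eq B ba assms(1) by (auto simp: p_def q_def norm_divide)
  hence "(norm p)\<^sup>2 = 1" "(norm q)\<^sup>2 = 1" "(norm (p - 1))\<^sup>2 = 1" "(norm (q - 1))\<^sup>2 = 1" "(norm (p - q))\<^sup>2 = 1"
    by simp_all
  hence n: "(Re p)\<^sup>2 + (Im p)\<^sup>2 = 1" "(Re q)\<^sup>2 + (Im q)\<^sup>2 = 1" "(Re p - 1)\<^sup>2 + (Im p)\<^sup>2 = 1"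
    "(Re q - 1)\<^sup>2 + (Im q)\<^sup>2 = 1" "(Re p - Re q)\<^sup>2 + (Im p - Im q)\<^sup>2 = 1"
    by (auto simp: cmod_power2)
  have re: "Re p = 1 / 2" "Re q = 1 / 2"
    using n(1,3) n(2,4) by (auto simp: power2_eq_square algebra_simps)
  have i: "(Im p)\<^sup>2 = 3 / 4" "(Im q)\<^sup>2 = 3 / 4"
    using n(1,2) unfolding re by (simp_all add: power_divide)
  moreover have "Im p * Im q = 1 / 4"
    using n(5) i unfolding re power2_diff by (simp add: power2_eq_square)
  ultimately have i: "(Im p)\<^sup>2 = 3 / 4" "(Im q)\<^sup>2 = 3 / 4" "Im p * Im q = 1 / 4" .
  have "(Im p * Im q)\<^sup>2 = 9 / 16" by (simp only: power_mult_distrib i(1,2))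
  thus False unfolding i(3) by (simp add: power_divide)
qed

section \<open>The contact graph\<close>

definition contact :: "('i \<Rightarrow> complex) \<Rightarrow> ('i \<Rightarrow> real) \<Rightarrow> 'i \<Rightarrow> 'i \<Rightarrow> bool" where
  "contact a s i j \<longleftrightarrow> norm (a i - a j) = s i * s j"

lemma contact_sym: "contact a s i j \<longleftrightarrow> contact a s j i"
  by (simp add: contact_def norm_minus_commute mult.commute)

text \<open>A horosphere based at \<open>a i\<close> of Euclidean diameter \<open>(s i)\<^sup>2\<close>; distinct concentric
  ones are disjoint.\<close>

definition base_packing :: "('i \<Rightarrow> complex) \<Rightarrow> ('i \<Rightarrow> real) \<Rightarrow> 'i set \<Rightarrow> bool" where
  "base_packing a s V \<longleftrightarrow> finite V \<and> (\<forall>i\<in>V. s i > 0) \<and>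
     (\<forall>i\<in>V. \<forall>j\<in>V. i \<noteq> j \<longrightarrow> norm (a i - a j) \<ge> s i * s j \<or> a i = a j \<and> s i \<noteq> s j)"

lemma base_packing_subset: "base_packing a s V \<Longrightarrow> W \<subseteq> V \<Longrightarrow> base_packing a s W"
  by (auto simp: base_packing_def intro: finite_subset; blast)

definition edges :: "('i \<Rightarrow> 'i \<Rightarrow> bool) \<Rightarrow> 'i set \<Rightarrow> 'i set set" where
  "edges R V = {{i, j} | i j. i \<in> V \<and> j \<in> V \<and> i \<noteq> j \<and> R i j}"

text \<open>The map z -> 1/z centred at \<open>a i\<close> differs from reflection in the unit
  circle only by conjugation. It preserves the sign of the real part of \<open>a j - a i\<close>, on
  which the choice of a leftmost sphere relies.\<close>

definition inverted :: "('i \<Rightarrow> complex) \<Rightarrow> 'i \<Rightarrow> 'i \<Rightarrow> complex" where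
  "inverted a i j = inverse (a j - a i)"

text \<open>Inversion at \<open>a i\<close> turns the neighbours of \<open>i\<close> into horospheres of equal size,
  whose base points are therefore uniformly separated.\<close>

lemma inverted_neighbours:
  assumes "base_packing a s V" "i \<in> V"
  defines "N \<equiv> {j \<in> V - {i}. contact a s i j}"
  defines "b \<equiv> inverted a i"
  shows "j \<in> N \<Longrightarrow> norm (b j) = 1 / (s i * s j)"
    and "j \<in> N \<Longrightarrow> k \<in> N \<Longrightarrow> j \<noteq> k \<Longrightarrow> norm (b j - b k) = norm (a j - a k) / (s j * s k) / (s i)\<^sup>2"
    and "j \<in> N \<Longrightarrow> k \<in> N \<Longrightarrow> j \<noteq> k \<Longrightarrow> norm (b j - b k) \<ge> 1 / (s i)\<^sup>2"
    and "inj_on b N"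
proof -
  have pos: "s j > 0" if "j \<in> V" for j using that assms by (auto simp: base_packing_def)
  have N: "norm (a j - a i) = s i * s j" "a j - a i \<noteq> 0" "s i > 0" "s j > 0" "j \<in> V" if "j \<in> N" for j
  proof -
    show *: "norm (a j - a i) = s i * s j" "s i > 0" "s j > 0" "j \<in> V"
      using that pos assms by (auto simp: N_def contact_def norm_minus_commute)
    from this show "a j - a i \<noteq> 0" by auto
  qed
  show "norm (b j) = 1 / (s i * s j)" if "j \<in> N" for j
    unfolding b_def inverted_def norm_inverse N(1)[OF that] by (rule inverse_eq_divide)
  show 2: "norm (b j - b k) = norm (a j - a k) / (s j * s k) / (s i)\<^sup>2" if "j \<in> N" "k \<in> N" "j \<noteq> k" for j k
  proof -
    have "b j - b k = (a k - a j) / ((a j - a i) * (a k - a i))"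
      using N(2)[OF that(1)] N(2)[OF that(2)] unfolding b_def inverted_def by (simp add: field_simps)
    thus ?thesis using N(1)[OF that(1)] N(1)[OF that(2)]
      by (simp add: norm_divide norm_mult norm_minus_commute power2_eq_square mult_ac)
  qed
  show 3: "norm (b j - b k) \<ge> 1 / (s i)\<^sup>2" if "j \<in> N" "k \<in> N" "j \<noteq> k" for j k
  proof -
    \<comment> \<open>Two neighbours of \<open>i\<close> with the same base point have the same
      distance to \<open>a i\<close>, hence the same size. This rules out the concentric alternative
      of \<open>base_packing\<close>.\<close>
    have "\<not> (a j = a k \<and> s j \<noteq> s k)" using N(1)[OF that(1)] N(1)[OF that(2)] N(3)[OF that(1)] by auto
    hence "norm (a j - a k) \<ge> s j * s k"
      using assms(1) that N(5) unfolding base_packing_def by blast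
    hence "1 \<le> norm (a j - a k) / (s j * s k)" using N(4)[OF that(1)] N(4)[OF that(2)] by simp
    thus ?thesis unfolding 2[OF that] by (intro divide_right_mono) auto
  qed
  show "inj_on b N"
  proof (rule inj_onI, rule ccontr)
    fix j k assume jk: "j \<in> N" "k \<in> N" "b j = b k" "j \<noteq> k"
    have "1 / (s i)\<^sup>2 > 0" using N(3)[OF jk(1)] by simp
    thus False using 3[OF jk(1,2,4)] jk(3) by simp
  qed
qed

text \<open>Take the leftmost among the smallest horospheres: if all its inverted neighbours
  lie on the boundary circle they are equally small, hence on its right.\<close>

lemma exists_small_degree:
  assumes P: "base_packing a s V" and "V \<noteq> {}"
  shows "\<exists>i\<in>V. card {j \<in> V - {i}. contact a s i j} \<le> 5"
proof -
  have fin: "finite V" using P by (simp add: base_packing_def)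
  define W where "W = {i \<in> V. s i = Min (s ` V)}"
  have "Min (s ` V) \<in> s ` V" using fin assms by (intro Min_in) auto
  hence W: "finite W" "W \<noteq> {}" using fin by (auto simp: W_def)
  define i where "i = arg_min_on (\<lambda>i. Re (a i)) W"
  have iW: "i \<in> W" unfolding i_def using W by (intro arg_min_if_finite)
  have left: "Re (a i) \<le> Re (a j)" if "j \<in> W" for j
    unfolding i_def using W that by (intro arg_min_least)
  have small: "s i \<le> s j" if "j \<in> V" for j
    using iW that fin by (auto simp: W_def)
  have iV: "i \<in> V" using iW by (auto simp: W_def)
  define N where "N = {j \<in> V - {i}. contact a s i j}"
  define b where "b = inverted a i"
  note inv = inverted_neighbours[OF P iV, folded N_def, folded b_def]
  have pos: "s j > 0" if "j \<in> V" for j using that P by (auto simp: base_packing_def)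
  have NV: "N \<subseteq> V" by (auto simp: N_def)
  have "card (b ` N) \<le> 5"
  \<comment> \<open>Minimality of \<open>s i\<close> bounds the norms 1/(s_i s_j) by 1/s_i^2, which
    is also the separation of the inverted neighbours; so radius and separation agree.\<close>
  proof (rule card_separated_in_disc_le_5[where \<rho> = "1 / (s i)\<^sup>2"])
    fix z assume "z \<in> b ` N"
    then obtain j where j: "j \<in> N" "z = b j" by blast
    have ps: "s i > 0" "s j > 0" using pos iV NV j by auto
    have "norm z = 1 / (s i * s j)" using inv(1) j by simp
    moreover have "\<dots> \<le> 1 / (s i)\<^sup>2"
      using small[of j] j NV ps by (auto intro!: divide_left_mono simp: power2_eq_square)
    moreover have "1 / (s i * s j) > 0" using ps by simp
    ultimately show "z \<noteq> 0 \<and> norm z \<le> 1 / (s i)\<^sup>2" by auto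
  next
    fix z w assume "z \<in> b ` N" "w \<in> b ` N" "z \<noteq> w"
    thus "1 / (s i)\<^sup>2 \<le> norm (z - w)" using inv(3) by auto
  next
    have "\<forall>z\<in>b ` N. Re z \<ge> 0" if no: "\<not> (\<exists>z\<in>b ` N. norm z < 1 / (s i)\<^sup>2)"
    proof
      fix z assume z: "z \<in> b ` N"
      then obtain j where j: "j \<in> N" "z = b j" by blast
      have ps: "s i > 0" "s j > 0" using pos iV NV j by auto
      have "\<not> norm z < 1 / (s i)\<^sup>2" using no z by blast
      hence "1 / (s i)\<^sup>2 \<le> 1 / (s i * s j)" using inv(1) j by auto
      hence "s j \<le> s i" using ps by (simp add: field_simps power2_eq_square)
      hence "j \<in> W" using small[of j] j NV iW by (force simp: W_def)
      \<comment> \<open>Re (1/z) has the sign of Re z, and \<open>a i\<close> is leftmost in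
        \<open>W\<close>.\<close>
      thus "Re z \<ge> 0" using left[of j] j by (simp add: b_def inverted_def)
    qed
    thus "(\<exists>z\<in>b ` N. norm z < 1 / (s i)\<^sup>2) \<or> (\<forall>z\<in>b ` N. Re z \<ge> 0)" by blast
  qed
  hence "card N \<le> 5" by (simp add: card_image inv(4))
  thus ?thesis using iV N_def by blast
qed

text \<open>With all contacts present, inversion at one base point would leave four points at the
  common mutual distance 1/s_i^2.\<close>

lemma exists_non_contact:
  assumes P: "base_packing a s V" and "card V = 5"
  shows "\<exists>i\<in>V. \<exists>j\<in>V. i \<noteq> j \<and> \<not> contact a s i j"
proof (rule ccontr)
  assume "\<not> ?thesis"
  hence all: "contact a s i j" if "i \<in> V" "j \<in> V" "i \<noteq> j" for i j using that by blast
  obtain i where i: "i \<in> V" using assms(2) by fastforce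
  define N where "N = {j \<in> V - {i}. contact a s i j}"
  define b where "b = inverted a i"
  note inv = inverted_neighbours[OF P i, folded N_def, folded b_def]
  have pos: "s j > 0" if "j \<in> V" for j using that P by (auto simp: base_packing_def)
  have N: "N = V - {i}" using all i by (auto simp: N_def)
  have "card N = 4" using i assms(2) by (simp add: N card_Diff_singleton)
  hence "card (b ` N) = 4" by (simp add: card_image inv(4))
  moreover have "norm (z - w) = 1 / (s i)\<^sup>2" if zw: "z \<in> b ` N" "w \<in> b ` N" "z \<noteq> w" for z w
  proof -
    obtain j k where jk: "j \<in> N" "k \<in> N" "z = b j" "w = b k" "j \<noteq> k" using zw by blast
    have "norm (a j - a k) = s j * s k" using all[of j k] jk N by (auto simp: contact_def)
    moreover have "s j > 0" "s k > 0" using jk pos N by auto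
    ultimately show ?thesis using inv(2)[of j k] jk by auto
  qed
  moreover have "1 / (s i)\<^sup>2 > 0" using pos[OF i] by simp
  ultimately show False using card_equidistant_neq_4 by blast
qed

text \<open>Induction by deleting a vertex of degree at most 5, which lowers the right-hand side by
  exactly 5. For five vertices at least one of the ten pairs is missing, and 9 + 16 = 5 * 5. Writing
  the 16 on the left avoids truncated subtraction.\<close>

lemma card_edges_le:
  assumes "base_packing a s V" "card V \<ge> 5"
  shows "card (edges (contact a s) V) + 16 \<le> 5 * card V"
  using assms
proof (induction "card V" arbitrary: V rule: less_induct)
  case less
  have fin: "finite V" using less.prems by (simp add: base_packing_def)
  show ?case
  proof (cases "card V = 5")
    case True
    obtain i j where ij: "i \<in> V" "j \<in> V" "i \<noteq> j" "\<not> contact a s i j"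
      using exists_non_contact[OF less.prems(1) True] by blast
    let ?X = "{e. e \<subseteq> V \<and> card e = 2}"
    have "edges (contact a s) V \<subseteq> ?X - {{i, j}}"
      using ij contact_sym[of a s] by (auto simp: edges_def doubleton_eq_iff)
    moreover have finX: "finite ?X" using fin by simp
    ultimately have "card (edges (contact a s) V) \<le> card (?X - {{i, j}})"
      by (intro card_mono) auto
    also have "\<dots> = card ?X - 1" using ij by (intro card_Diff_singleton) auto
    also have "card ?X = 10" using n_subsets[OF fin, of 2] True by (simp add: choose_two)
    finally show ?thesis using True by simp
  next
    case False
    obtain i where i: "i \<in> V" "card {j \<in> V - {i}. contact a s i j} \<le> 5"
      using exists_small_degree[OF less.prems(1)] less.prems(2) by fastforce
    have card: "card (V - {i}) = card V - 1" using i by simp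
    have IH: "card (edges (contact a s) (V - {i})) + 16 \<le> 5 * card (V - {i})"
      using less.prems i False card
      by (intro less.hyps base_packing_subset[OF less.prems(1)]) auto
    let ?N = "{j \<in> V - {i}. contact a s i j}"
    have "edges (contact a s) V \<subseteq> edges (contact a s) (V - {i}) \<union> (\<lambda>j. {i, j}) ` ?N"
    proof
      fix e assume "e \<in> edges (contact a s) V"
      then obtain j k where e: "e = {j, k}" "j \<in> V" "k \<in> V" "j \<noteq> k" "contact a s j k"
        by (auto simp: edges_def)
      consider "j = i" | "k = i" | "j \<noteq> i" "k \<noteq> i" by blast
      thus "e \<in> edges (contact a s) (V - {i}) \<union> (\<lambda>j. {i, j}) ` ?N"
      proof cases
        case 1 thus ?thesis using e by auto
      next
        case 2
        hence "e = {i, j}" "j \<in> ?N" using e contact_sym[of a s] by auto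
        thus ?thesis by blast
      next
        case 3 thus ?thesis using e by (auto simp: edges_def)
      qed
    qed
    moreover have "finite (edges (contact a s) (V - {i}))"
      by (rule finite_subset[of _ "Pow V"]) (use fin in \<open>auto simp: edges_def\<close>)
    ultimately have "card (edges (contact a s) V) \<le> card (edges (contact a s) (V - {i}) \<union> (\<lambda>j. {i, j}) ` ?N)"
      using fin by (intro card_mono) auto
    also have "\<dots> \<le> card (edges (contact a s) (V - {i})) + card ((\<lambda>j. {i, j}) ` ?N)"
      by (rule card_Un_le)
    also have "card ((\<lambda>j. {i, j}) ` ?N) \<le> card ?N" using fin by (intro card_image_le) auto
    finally show ?thesis using IH i(2) card less.prems(2) by linarith
  qed
qed

section \<open>Spinor coordinates\<close>

text \<open>A vector of C^2 up to phase encodes a horosphere whose base point is the ratio of its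
  coordinates. The norm of this SL(2,C)-invariant form is the lambda length, the exponential of half
  the signed distance, so the value 1 means tangency.\<close>

definition det2 :: "complex \<times> complex \<Rightarrow> complex \<times> complex \<Rightarrow> complex" where
  "det2 v w = fst v * snd w - fst w * snd v"

text \<open>A generic shear moves all base points \<open>fst (v i) / snd (v i)\<close> away from infinity.\<close>

lemma card_edges_spinors_le:
  fixes v :: "'i \<Rightarrow> complex \<times> complex"
  assumes fin: "finite V" and card: "card V \<ge> 5" and nz: "\<And>i. i \<in> V \<Longrightarrow> v i \<noteq> 0"
    and sep: "\<And>i j. i \<in> V \<Longrightarrow> j \<in> V \<Longrightarrow> i \<noteq> j \<Longrightarrow> norm (det2 (v i) (v j)) \<ge> 1 \<or>
      (norm (fst (v i)), norm (snd (v i))) \<noteq> (norm (fst (v j)), norm (snd (v j))) \<and> det2 (v i) (v j) = 0"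
  shows "card (edges (\<lambda>i j. norm (det2 (v i) (v j)) = 1) V) + 16 \<le> 5 * card V"
proof -
  \<comment> \<open>Each \<open>v i\<close> forbids at most one shear parameter. If
    \<open>fst (v i) = 0\<close>, the quotient is 0 by convention, which only excludes \<epsilon> =
    0; then \<open>h i = snd (v i)\<close> is nonzero anyway.\<close>
  have "infinite (UNIV - (\<lambda>i. - snd (v i) / fst (v i)) ` V :: complex set)"
    using fin by (intro Diff_infinite_finite[OF finite_imageI] infinite_UNIV_char_0)
  hence "UNIV - (\<lambda>i. - snd (v i) / fst (v i)) ` V \<noteq> {}"
    by (rule infinite_imp_nonempty)
  then obtain \<epsilon> where \<epsilon>: "\<And>i. i \<in> V \<Longrightarrow> \<epsilon> \<noteq> - snd (v i) / fst (v i)"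
    by blast
  \<comment> \<open>The shear (x, y) -> (x, y + \<epsilon> x) has determinant 1 and so preserves
    \<open>det2\<close>. In the new coordinates the base point is x / h and the square root of the
    diameter is 1 / |h|.\<close>
  define h where "h = (\<lambda>i. snd (v i) + \<epsilon> * fst (v i))"
  define a where "a = (\<lambda>i. fst (v i) / h i)"
  define s where "s = (\<lambda>i. 1 / norm (h i))"
  have h: "h i \<noteq> 0" if "i \<in> V" for i
  proof
    assume 0: "h i = 0"
    show False
    proof (cases "fst (v i) = 0")
      case True
      thus False using 0 nz[OF that] by (auto simp: h_def prod_eq_iff)
    next
      case False
      have "\<epsilon> * fst (v i) = - snd (v i)" using 0 unfolding h_def by (simp only: eq_neg_iff_add_eq_0 add.commute)
      hence "\<epsilon> = - snd (v i) / fst (v i)" using False by (metis nonzero_eq_divide_eq)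
      thus False using \<epsilon>[OF that] by simp
    qed
  qed
  have dist: "norm (a i - a j) = norm (det2 (v i) (v j)) * (s i * s j)" if "i \<in> V" "j \<in> V" for i j
  proof -
    have "a i - a j = det2 (v i) (v j) / (h i * h j)"
      using h[OF that(1)] h[OF that(2)] unfolding a_def
      by (simp add: diff_frac_eq) (simp add: det2_def h_def algebra_simps)
    thus ?thesis by (simp add: s_def norm_divide norm_mult)
  qed
  have spos: "s i > 0" if "i \<in> V" for i using h[OF that] by (simp add: s_def)
  have "base_packing a s V"
    unfolding base_packing_def
  proof (intro conjI ballI impI)
    fix i j assume ij: "i \<in> V" "j \<in> V" "i \<noteq> j"
    have ss: "s i * s j > 0" using spos ij by simp
    show "s i * s j \<le> norm (a i - a j) \<or> a i = a j \<and> s i \<noteq> s j"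
    proof (cases "norm (det2 (v i) (v j)) \<ge> 1")
      case True
      thus ?thesis using dist[OF ij(1,2)] mult_right_mono[OF True less_imp_le[OF ss]] by simp
    next
      case False
      hence *: "det2 (v i) (v j) = 0"
        "(norm (fst (v i)), norm (snd (v i))) \<noteq> (norm (fst (v j)), norm (snd (v j)))"
        using sep[OF ij] by auto
      hence aa: "a i = a j" using dist[OF ij(1,2)] by simp
      moreover have "s i \<noteq> s j"
      proof
        assume "s i = s j"
        hence hh: "norm (h i) = norm (h j)" using h ij by (simp add: s_def)
        \<comment> \<open>Base point and \<open>h k\<close> determine the spinor. Equal base points
          and equal |h| therefore give equal norms of both coordinates, against
          \<open>sep\<close>.\<close>
        have f: "fst (v k) = a k * h k" "snd (v k) = (1 - \<epsilon> * a k) * h k" if "k \<in> V" for k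
        proof -
          show f: "fst (v k) = a k * h k" using h[OF that] by (simp add: a_def)
          have "snd (v k) = h k - \<epsilon> * fst (v k)" by (simp add: h_def)
          thus "snd (v k) = (1 - \<epsilon> * a k) * h k" unfolding f by (simp add: algebra_simps)
        qed
        show False using *(2) ij by (simp add: f norm_mult aa hh)
      qed
      ultimately show ?thesis by blast
    qed
  qed (use fin spos in auto)
  from card_edges_le[OF this card]
  have "card (edges (contact a s) V) + 16 \<le> 5 * card V" .
  moreover have "edges (contact a s) V = edges (\<lambda>i j. norm (det2 (v i) (v j)) = 1) V"
  proof -
    have "contact a s i j \<longleftrightarrow> norm (det2 (v i) (v j)) = 1" if "i \<in> V" "j \<in> V" for i j
      using dist[OF that] spos[OF that(1)] spos[OF that(2)] by (simp add: contact_def)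
    thus ?thesis unfolding edges_def by blast
  qed
  ultimately show ?thesis by simp
qed

section \<open>Tangency of horospheres\<close>

text \<open>Along a curve in the sphere the squared distance to \<open>c\<close> is constant near 0,
  while its derivative at 0 is twice the inner product.\<close>

lemma tangent_vectors_sphere_subset:
  fixes c :: "'a::real_inner"
  assumes "v \<in> tangent_vectors (sphere c r \<inter> U) p"
  shows "v \<bullet> (p - c) = 0"
proof -
  obtain \<gamma> where \<gamma>: "\<gamma> 0 = p" "\<forall>\<^sub>F s in nhds 0. \<gamma> s \<in> sphere c r \<inter> U" "(\<gamma> has_vector_derivative v) (at 0)"
    using assms by (auto simp: tangent_vectors_def)
  define f where "f = (\<lambda>s. (\<gamma> s - c) \<bullet> (\<gamma> s - c))"
  have d: "(f has_real_derivative 2 * (v \<bullet> (p - c))) (at 0)"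
    unfolding f_def has_field_derivative_def
    using \<gamma>(3)[unfolded has_vector_derivative_def]
    by (auto intro!: derivative_eq_intros simp: \<gamma>(1) inner_commute algebra_simps fun_eq_iff)
  have "\<forall>\<^sub>F s in nhds 0. f s = r\<^sup>2"
    using \<gamma>(2) by eventually_elim (auto simp: f_def dist_norm norm_minus_commute simp flip: power2_norm_eq_inner)
  hence "(f has_real_derivative 0) (at 0) \<longleftrightarrow> ((\<lambda>_. r\<^sup>2) has_real_derivative 0) (at (0::real))"
    by (intro DERIV_cong_ev) auto
  hence "(f has_real_derivative 0) (at 0)" by simp
  from DERIV_unique[OF d this] show ?thesis by simp
qed

text \<open>Conversely, the radial projection to the sphere of the line through \<open>p\<close> in
  direction \<open>v\<close> has velocity \<open>v\<close>: the norm is stationary at 0 because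
  \<open>v\<close> is orthogonal to the radius. Openness of \<open>U\<close> keeps the curve in
  \<open>U\<close> for small parameters.\<close>

lemma tangent_vectors_sphere:
  fixes c :: "'a::real_inner"
  assumes "open U" "p \<in> sphere c r" "p \<in> U" "r > 0"
  shows "tangent_vectors (sphere c r \<inter> U) p = {v. v \<bullet> (p - c) = 0}"
proof (intro equalityI subsetI)
  fix v assume "v \<in> {v. v \<bullet> (p - c) = 0}"
  hence v: "v \<bullet> (p - c) = 0" by simp
  define q where "q = p - c"
  have q: "norm q = r" using assms(2) by (simp add: q_def dist_norm norm_minus_commute)
  have qv: "norm (q + s *\<^sub>R v) \<noteq> 0" for s
  proof -
    have "(norm (q + s *\<^sub>R v))\<^sup>2 = r\<^sup>2 + s\<^sup>2 * (norm v)\<^sup>2"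
      using v q by (simp add: norm_add_Pythagorean orthogonal_def inner_commute power_mult_distrib flip: q_def)
    moreover have "r\<^sup>2 + s\<^sup>2 * (norm v)\<^sup>2 > 0" using assms(4) by (intro add_pos_nonneg) auto
    ultimately show ?thesis by (metis less_irrefl zero_power2)
  qed
  define \<gamma> where "\<gamma> = (\<lambda>s. c + (r / norm (q + s *\<^sub>R v)) *\<^sub>R (q + s *\<^sub>R v))"
  have 0: "\<gamma> 0 = p" using q assms(4) by (simp add: \<gamma>_def q_def)
  have q0: "q \<noteq> 0" using q assms(4) by auto
  have "((\<lambda>s. norm (q + s *\<^sub>R v)) has_derivative (\<lambda>s. 0)) (at 0)"
  proof -
    have "((\<lambda>s. norm (q + s *\<^sub>R v)) has_derivative (\<lambda>t. (t *\<^sub>R v) \<bullet> sgn (q + 0 *\<^sub>R v))) (at 0)"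
      by (rule has_derivative_norm[THEN has_derivative_compose[rotated]] derivative_eq_intros | use q0 in simp)+
    thus ?thesis using v by (simp add: sgn_div_norm q_def[symmetric] inner_commute)
  qed
  hence n: "((\<lambda>s. norm (q + s *\<^sub>R v)) has_real_derivative 0) (at 0)"
    by (simp add: has_field_derivative_def lambda_zero)
  have "((\<lambda>s. r / norm (q + s *\<^sub>R v)) has_real_derivative 0) (at 0)"
    using DERIV_divide[OF DERIV_const n, of r] qv[of 0] by simp
  moreover have "((\<lambda>s. q + s *\<^sub>R v) has_vector_derivative v) (at 0)"
    by (auto intro!: derivative_eq_intros)
  ultimately have "((\<lambda>s. (r / norm (q + s *\<^sub>R v)) *\<^sub>R (q + s *\<^sub>R v)) has_vector_derivative
      (r / norm (q + 0 *\<^sub>R v)) *\<^sub>R v + 0 *\<^sub>R (q + 0 *\<^sub>R v)) (at 0)"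
    by (rule has_vector_derivative_scaleR)
  hence "(\<gamma> has_vector_derivative v) (at 0)"
    unfolding \<gamma>_def using q assms(4) 
    by (simp add: has_vector_derivative_add_const add.commute[of c])
  moreover have "\<forall>\<^sub>F s in nhds 0. \<gamma> s \<in> sphere c r \<inter> U"
  proof -
    have "isCont \<gamma> 0"
      unfolding \<gamma>_def using qv[of 0] by (intro continuous_intros) auto
    hence "\<forall>\<^sub>F s in nhds 0. \<gamma> s \<in> U"
      using assms(1,3) 0 by (auto simp: continuous_at tendsto_def eventually_at_filter elim!: allE[of _ U] eventually_mono)
    moreover have "\<gamma> s \<in> sphere c r" for s
      using qv[of s] assms(4) by (simp add: \<gamma>_def dist_norm)
    ultimately show ?thesis by (auto elim: eventually_mono)
  qed
  ultimately show "v \<in> tangent_vectors (sphere c r \<inter> U) p"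
    using 0 by (auto simp: tangent_vectors_def)
qed (use tangent_vectors_sphere_subset in auto)

lemma tangent_vectors_plane:
  fixes p :: "complex \<times> real"
  assumes "p \<in> upper_half_space" "snd p = h"
  shows "tangent_vectors {p \<in> upper_half_space. snd p = h} p = {v. v \<bullet> (0, 1) = 0}"
proof (intro equalityI subsetI)
  fix v assume "v \<in> tangent_vectors {p \<in> upper_half_space. snd p = h} p"
  then obtain \<gamma> where \<gamma>: "\<gamma> 0 = p" "\<forall>\<^sub>F s in nhds 0. snd (\<gamma> s) = h" "(\<gamma> has_vector_derivative v) (at 0)"
    unfolding tangent_vectors_def eventually_conj_iff mem_Collect_eq by blast
  have "((\<lambda>s. snd (\<gamma> s)) has_vector_derivative snd v) (at 0)"
    using bounded_linear.has_vector_derivative[OF bounded_linear_snd \<gamma>(3)] .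
  hence d: "((\<lambda>s. snd (\<gamma> s)) has_real_derivative snd v) (at 0)"
    by (simp add: has_real_derivative_iff_has_vector_derivative)
  have "((\<lambda>s. snd (\<gamma> s)) has_real_derivative 0) (at 0) \<longleftrightarrow> ((\<lambda>_. h) has_real_derivative 0) (at (0::real))"
    using \<gamma>(2) by (intro DERIV_cong_ev) auto
  hence "snd v = 0" using DERIV_unique[OF d] by simp
  thus "v \<in> {v. v \<bullet> (0, 1) = 0}" by (simp add: inner_prod_def)
next
  fix v :: "complex \<times> real" assume "v \<in> {v. v \<bullet> (0, 1) = 0}"
  hence v: "snd v = 0" by (simp add: inner_prod_def)
  have "((\<lambda>s. p + s *\<^sub>R v) has_vector_derivative v) (at 0)"
    by (auto intro!: derivative_eq_intros)
  thus "v \<in> tangent_vectors {p \<in> upper_half_space. snd p = h} p"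
    unfolding tangent_vectors_def using assms v
    by (auto intro!: exI[of _ "\<lambda>s. p + s *\<^sub>R v"] simp: upper_half_space_def)
qed

text \<open>The component \<open>u\<close> of \<open>m\<close> orthogonal to \<open>n\<close> lies
  in the common hyperplane, so it is orthogonal to \<open>m\<close> too, hence to itself. For n = 0
  division by zero makes l = 0, and the argument still goes through.\<close>

lemma parallel_of_same_hyperplane:
  fixes m n :: "'a::real_inner"
  assumes "{v. v \<bullet> m = 0} = {v. v \<bullet> n = 0}"
  shows "\<exists>l. m = l *\<^sub>R n"
proof -
  define l where "l = (m \<bullet> n) / (n \<bullet> n)"
  define u where "u = m - l *\<^sub>R n"
  have "u \<bullet> n = 0" by (cases "n = 0") (simp_all add: u_def l_def inner_diff_left)
  moreover from this have "u \<bullet> m = 0" using assms by auto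
  ultimately have "u \<bullet> u = 0" by (simp add: u_def inner_diff_right)
  thus ?thesis unfolding u_def by auto
qed

section \<open>Tangency and disjointness in terms of base points and radii\<close>

lemma open_upper_half_space: "open upper_half_space"
  unfolding upper_half_space_def by (intro open_Collect_less continuous_intros)

definition horoplane :: "real \<Rightarrow> (complex \<times> real) set" where
  "horoplane h = {p \<in> upper_half_space. snd p = h}"

definition horoball_sphere :: "complex \<Rightarrow> real \<Rightarrow> (complex \<times> real) set" where
  "horoball_sphere a r = sphere (a, r) r \<inter> upper_half_space"

lemma mem_sphere_prod:
  fixes p :: "complex \<times> real"
  assumes "r \<ge> 0"
  shows "p \<in> sphere (a, q) r \<longleftrightarrow> (norm (fst p - a))\<^sup>2 + (snd p - q)\<^sup>2 = r\<^sup>2"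
proof -
  have "p \<in> sphere (a, q) r \<longleftrightarrow> (dist p (a, q))\<^sup>2 = r\<^sup>2"
    using assms by (auto simp: dist_commute)
  also have "(dist p (a, q))\<^sup>2 = (norm (fst p - a))\<^sup>2 + (snd p - q)\<^sup>2"
    by (simp add: dist_norm norm_prod_def)
  finally show ?thesis .
qed

lemma mem_horoball_sphere:
  assumes "r > 0"
  shows "p \<in> horoball_sphere a r \<longleftrightarrow> snd p > 0 \<and> (norm (fst p - a))\<^sup>2 + (snd p)\<^sup>2 = 2 * r * snd p"
proof -
  have "p \<in> sphere (a, r) r \<longleftrightarrow> (norm (fst p - a))\<^sup>2 + (snd p - r)\<^sup>2 = r\<^sup>2"
    by (rule mem_sphere_prod) (use assms in simp)
  thus ?thesis
    by (auto simp: horoball_sphere_def upper_half_space_def power2_eq_square algebra_simps)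
qed

text \<open>A common tangent plane makes the radius vectors at \<open>p\<close> parallel, with a
  factor \<open>l\<close> of absolute value r/q. A negative factor is external tangency, with
  centres r + q apart; a positive one is internal tangency, with centres |r - q| apart.\<close>

lemma tangent_spheresD:
  assumes "r > 0" "q > 0" "tangent (horoball_sphere a r) (horoball_sphere b q)"
    and ne: "horoball_sphere a r \<noteq> horoball_sphere b q"
  shows "(norm (a - b))\<^sup>2 = 4 * r * q"
proof -
  obtain p where p: "p \<in> horoball_sphere a r" "p \<in> horoball_sphere b q"
    "tangent_vectors (horoball_sphere a r) p = tangent_vectors (horoball_sphere b q) p"
    using assms(3) by (auto simp: tangent_def)
  have t: "snd p > 0" using p mem_horoball_sphere assms by blast
  have "{v. v \<bullet> (p - (a, r)) = 0} = {v. v \<bullet> (p - (b, q)) = 0}"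
    using p assms tangent_vectors_sphere[OF open_upper_half_space]
    by (auto simp: horoball_sphere_def)
  then obtain l where l: "p - (a, r) = l *\<^sub>R (p - (b, q))" using parallel_of_same_hyperplane by blast
  have "norm (p - (a, r)) = r" "norm (p - (b, q)) = q"
    using p by (auto simp: horoball_sphere_def dist_norm norm_minus_commute)
  hence "\<bar>l\<bar> * q = r" using l by simp
  hence "l * q = r \<or> l * q = - r" by linarith
  have "(a, r) - (b, q) = (p - (b, q)) - (p - (a, r))" by simp
  also have "\<dots> = (1 - l) *\<^sub>R (p - (b, q))" unfolding l by (simp add: scaleR_left_diff_distrib)
  finally have "(a, r) - (b, q) = (1 - l) *\<^sub>R (p - (b, q))" .
  hence "norm ((a, r) - (b, q)) = \<bar>1 - l\<bar> * q" using \<open>norm (p - (b, q)) = q\<close> by simp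
  hence "(norm ((a, r) - (b, q)))\<^sup>2 = (q - l * q)\<^sup>2"
    by (simp add: power_mult_distrib algebra_simps flip: power_mult_distrib)
      (simp add: power2_eq_square algebra_simps)
  moreover have "(norm ((a, r) - (b, q)))\<^sup>2 = (norm (a - b))\<^sup>2 + (r - q)\<^sup>2"
    by (simp add: norm_Pair)
  ultimately have eq: "(norm (a - b))\<^sup>2 + (r - q)\<^sup>2 = (q - l * q)\<^sup>2" by simp
  show ?thesis
  proof (cases "l * q = r")
    \<comment> \<open>Internal tangency forces equal base points, and the equations at the common
      point, of positive height, then give equal radii, so the spheres coincide.\<close>
    case True
    hence "a = b" using eq by (simp add: power2_commute)
    hence "r * snd p = q * snd p" using p assms by (auto simp: mem_horoball_sphere)
    thus ?thesis using ne t \<open>a = b\<close> by auto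
  next
    case False
    hence "l * q = - r" using \<open>l * q = r \<or> _\<close> by blast
    thus ?thesis using eq by (simp add: power2_eq_square algebra_simps)
  qed
qed

text \<open>Otherwise the distance of the centres lies strictly between |r - q| and r + q. By
  connectedness of the first sphere, the distance from the second centre takes the value
  \<open>q\<close> on it, so the spheres meet.\<close>

lemma disjoint_spheresD:
  assumes "r > 0" "q > 0" "horoball_sphere a r \<inter> horoball_sphere b q = {}" "a \<noteq> b"
  shows "(norm (a - b))\<^sup>2 \<ge> 4 * r * q"
proof (rule ccontr)
  assume less: "\<not> ?thesis"
  define D where "D = dist (a, r) (b, q)"
  have D2: "D\<^sup>2 = (norm (a - b))\<^sup>2 + (r - q)\<^sup>2" by (simp add: D_def dist_norm norm_Pair)
  have D0: "D > 0" using assms(4) by (simp add: D_def)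
  have "D\<^sup>2 < (r + q)\<^sup>2" using less unfolding D2 by (simp add: power2_eq_square algebra_simps)
  hence D1: "D < r + q" using assms by (auto intro: power_less_imp_less_base)
  have "\<bar>r - q\<bar>\<^sup>2 < D\<^sup>2" unfolding D2 using assms(4) by simp
  hence D3: "\<bar>r - q\<bar> < D" using D0 by (intro power_less_imp_less_base[of "\<bar>r - q\<bar>" 2 D]) auto
  \<comment> \<open>The point of the first sphere in the direction of the second centre, at distance
    |r - D| from it, lies in the second ball. The base point \<open>(a, 0)\<close> is not in its
    interior.\<close>
  define x where "x = (a, r) + (r / D) *\<^sub>R ((b, q) - (a, r))"
  have nD: "norm ((b, q) - (a, r)) = D" by (simp only: D_def dist_norm norm_minus_commute)
  have "norm (x - (a, r)) = r" unfolding x_def add_diff_cancel_left' norm_scaleR nD using D0 assms(1) by simp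
  hence x1: "x \<in> sphere (a, r) r" by (simp add: dist_norm norm_minus_commute)
  have "x - (b, q) = (r / D - 1) *\<^sub>R ((b, q) - (a, r))" by (simp add: x_def algebra_simps)
  hence "norm (x - (b, q)) = \<bar>r / D - 1\<bar> * D" by (simp only: norm_scaleR nD)
  also have "\<dots> = \<bar>r - D\<bar>" using D0 by (simp add: abs_mult_pos' field_simps flip: abs_mult_pos)
  finally have x2: "dist (b, q) x \<le> q" using D1 D3 by (simp add: dist_norm norm_minus_commute)
  have y1: "(a, 0) \<in> sphere (a, r) r" using assms by (simp add: dist_prod_def dist_norm)
  have "q\<^sup>2 \<le> (dist (b, q) (a, 0))\<^sup>2" by (simp add: dist_prod_def dist_norm)
  hence y2: "q \<le> dist (b, q) (a, 0)" using power2_le_imp_le by (metis zero_le_dist)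
  have "connected (sphere (a, r) r)" by (rule connected_sphere) (simp add: DIM_prod)
  hence "connected (dist (b, q) ` sphere (a, r) r)"
    by (intro connected_continuous_image continuous_intros)
  hence "q \<in> dist (b, q) ` sphere (a, r) r"
    using x1 x2 y1 y2 connectedD_interval[of _ "dist (b, q) x" "dist (b, q) (a, 0)" q] by blast
  then obtain p where p: "p \<in> sphere (a, r) r" "dist (b, q) p = q" by auto
  have e: "(norm (fst p - a))\<^sup>2 + (snd p - r)\<^sup>2 = r\<^sup>2" "(norm (fst p - b))\<^sup>2 + (snd p - q)\<^sup>2 = q\<^sup>2"
    using p assms by (auto simp flip: mem_sphere_prod)
  have e1: "(norm (fst p - a))\<^sup>2 + (snd p)\<^sup>2 = 2 * r * snd p" "(norm (fst p - b))\<^sup>2 + (snd p)\<^sup>2 = 2 * q * snd p"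
    using e by (auto simp: power2_eq_square algebra_simps)
  have "2 * r * snd p \<ge> 0" using e1(1) by (metis add_nonneg_nonneg zero_le_power2)
  hence "snd p \<ge> 0" using assms by (simp add: zero_le_mult_iff)
  \<comment> \<open>At height 0 both equations make \<open>p\<close> the base point of its sphere,
    which would give a = b.\<close>
  moreover have "snd p \<noteq> 0" using e1 assms(4) by auto
  ultimately have "snd p > 0" by simp
  hence "p \<in> horoball_sphere a r \<inter> horoball_sphere b q"
    unfolding Int_iff mem_horoball_sphere[OF assms(1)] mem_horoball_sphere[OF assms(2)] using e1 by blast
  thus False using assms(3) by blast
qed

text \<open>A horizontal tangent plane puts the common point on the vertical line through the
  centre; having positive height, it is the top of the sphere.\<close>

lemma tangent_plane_sphereD:
  assumes "q > 0" "tangent (horoplane h) (horoball_sphere b q) \<or> tangent (horoball_sphere b q) (horoplane h)"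
  shows "h = 2 * q"
proof -
  obtain p where p: "p \<in> horoplane h" "p \<in> horoball_sphere b q"
    "tangent_vectors (horoball_sphere b q) p = tangent_vectors (horoplane h) p"
    using assms(2) by (auto simp: tangent_def)
  have "{v. v \<bullet> (p - (b, q)) = 0} = {v. v \<bullet> (0, 1) = 0}"
    using p assms(1) tangent_vectors_sphere[OF open_upper_half_space] tangent_vectors_plane
    by (auto simp: horoball_sphere_def horoplane_def)
  then obtain l where "p - (b, q) = l *\<^sub>R (0, 1)" using parallel_of_same_hyperplane by blast
  hence "fst p = b" by (cases p) auto
  thus ?thesis using p assms by (auto simp: mem_horoball_sphere horoplane_def power2_eq_square)
qed

lemma disjoint_plane_sphereD:
  assumes "q > 0" "h > 0" "horoplane h \<inter> horoball_sphere b q = {}"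
  shows "h \<ge> 2 * q"
proof (rule ccontr)
  assume less: "\<not> ?thesis"
  have "h * (2 * q - h) \<ge> 0" using less assms by simp
  \<comment> \<open>The slice of the sphere at height \<open>h\<close> is a circle of radius sqrt (h
    (2 q - h)) about \<open>b\<close>; the witness lies on it.\<close>
  hence "(b + of_real (sqrt (h * (2 * q - h))), h) \<in> horoball_sphere b q"
    using assms(1,2) by (simp add: mem_horoball_sphere) (simp add: power2_eq_square algebra_simps)
  hence "(b + of_real (sqrt (h * (2 * q - h))), h) \<in> horoplane h \<inter> horoball_sphere b q"
    by (simp add: horoplane_def horoball_sphere_def)
  thus False using assms(3) by blast
qed

text \<open>Two spinors have determinant of norm \<open>\<bar>a - b\<bar> / (2 sqrt (r q))\<close> for two spheres
  and \<open>sqrt (h / (2 q))\<close> for a plane and a sphere.\<close>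

definition spinor_of :: "(complex \<times> real) set \<Rightarrow> complex \<times> complex \<Rightarrow> bool" where
  "spinor_of S v \<longleftrightarrow>
     (\<exists>h>0. S = horoplane h \<and> v = (of_real (sqrt h), 0)) \<or>
     (\<exists>a r. r > 0 \<and> S = horoball_sphere a r \<and> v = (a / of_real (sqrt (2 * r)), 1 / of_real (sqrt (2 * r))))"

section \<open>Separation of the spinors of two horospheres\<close>

lemma horosphere_spinor: "horosphere S \<Longrightarrow> \<exists>v. spinor_of S v"
  unfolding horosphere_def spinor_of_def horoplane_def horoball_sphere_def by blast

lemma spinor_of_nonzero: "spinor_of S v \<Longrightarrow> v \<noteq> 0"
  by (auto simp: spinor_of_def zero_prod_def)

lemma norm_det2_spheres:
  assumes "r > 0" "q > 0"
  shows "(norm (det2 (a / of_real (sqrt (2 * r)), 1 / of_real (sqrt (2 * r)))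
      (b / of_real (sqrt (2 * q)), 1 / of_real (sqrt (2 * q)))))\<^sup>2 = (norm (a - b))\<^sup>2 / (4 * r * q)"
proof -
  have "det2 (a / of_real (sqrt (2 * r)), 1 / of_real (sqrt (2 * r)))
      (b / of_real (sqrt (2 * q)), 1 / of_real (sqrt (2 * q))) = (a - b) / of_real (sqrt (2 * r) * sqrt (2 * q))"
    by (simp add: det2_def diff_divide_distrib mult.commute)
  thus ?thesis using assms by (simp add: norm_divide norm_mult power_divide power_mult_distrib)
qed

lemma norm_det2_plane_sphere:
  assumes "h > 0" "q > 0"
  shows "(norm (det2 (of_real (sqrt h), 0) (b / of_real (sqrt (2 * q)), 1 / of_real (sqrt (2 * q)))))\<^sup>2 = h / (2 * q)"
  using assms by (simp add: det2_def norm_divide power_divide)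

lemma det2_swap: "norm (det2 w v) = norm (det2 v w)"
  by (simp add: det2_def norm_minus_commute)

text \<open>Horospheres with a common base point, whether two planes or two spheres, have
  determinant 0 and are told apart by the coordinate norms; distinct ones are never tangent. For
  different base points the metric criteria become the determinant conditions after
  squaring.\<close>

lemma spinor_separation:
  assumes "spinor_of S v" "spinor_of T w" "S \<noteq> T" "S \<inter> T = {} \<or> tangent S T"
  shows "norm (det2 v w) \<ge> 1 \<or>
      (norm (fst v), norm (snd v)) \<noteq> (norm (fst w), norm (snd w)) \<and> det2 v w = 0"
    and "tangent S T \<Longrightarrow> norm (det2 v w) = 1"
proof -
  have sq: "norm x \<ge> 1 \<longleftrightarrow> (norm x)\<^sup>2 \<ge> 1" "norm x = 1 \<longleftrightarrow> (norm x)\<^sup>2 = 1" for x :: complex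
    by (auto simp: power2_eq_1_iff abs_square_le_1 power2_nonneg_ge_1_iff) (use norm_ge_zero[of x] in linarith)
  let ?C = "(norm (det2 v w) \<ge> 1 \<or>
      (norm (fst v), norm (snd v)) \<noteq> (norm (fst w), norm (snd w)) \<and> det2 v w = 0) \<and>
      (tangent S T \<longrightarrow> norm (det2 v w) = 1)"
  have *: ?C
    if "h > 0" "S = horoplane h" "v = (of_real (sqrt h), 0)" "k > 0" "T = horoplane k" "w = (of_real (sqrt k), 0)" for h k
  proof -
    have "h \<noteq> k" using that assms by auto
    moreover have "\<not> tangent S T" using that \<open>h \<noteq> k\<close> by (auto simp: tangent_def horoplane_def)
    ultimately show ?thesis using that by (auto simp: det2_def)
  qed
  \<comment> \<open>The sets and spinors are quantified afresh, and tangency is taken in both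
    orders, so that this serves plane-sphere and sphere-plane alike.\<close>
  have **: "norm (det2 v w) \<ge> 1 \<and> (tangent S T \<or> tangent T S \<longrightarrow> norm (det2 v w) = 1)"
    if "h > 0" "S = horoplane h" "v = (of_real (sqrt h), 0)" "r > 0" "T = horoball_sphere a r"
      "w = (a / of_real (sqrt (2 * r)), 1 / of_real (sqrt (2 * r)))" "S \<inter> T = {} \<or> tangent S T \<or> tangent T S"
    for h a r S T v w
    using tangent_plane_sphereD[of r h a] disjoint_plane_sphereD[of r h a] that(1,2,4,5,7)
    unfolding sq unfolding that(3,6) norm_det2_plane_sphere[OF that(1,4)] by auto
  have ***: ?C
    if r: "r > 0" "S = horoball_sphere a r" "v = (a / of_real (sqrt (2 * r)), 1 / of_real (sqrt (2 * r)))"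
      "q > 0" "T = horoball_sphere b q" "w = (b / of_real (sqrt (2 * q)), 1 / of_real (sqrt (2 * q)))" for a r b q
  proof (cases "a = b")
    case True
    hence "r \<noteq> q" using r assms by auto
    moreover have "\<not> tangent S T"
      using tangent_spheresD[of r q a b] r assms True by auto
    ultimately show ?thesis using r True by (auto simp: det2_def norm_divide)
  next
    case False
    have "tangent S T \<Longrightarrow> (norm (a - b))\<^sup>2 = 4 * r * q" "S \<inter> T = {} \<Longrightarrow> (norm (a - b))\<^sup>2 \<ge> 4 * r * q"
      using tangent_spheresD[of r q a b] disjoint_spheresD[of r q a b] r assms False by auto
    hence "norm (det2 v w) \<ge> 1 \<and> (tangent S T \<longrightarrow> norm (det2 v w) = 1)"
      using r(1,4) assms(4) unfolding sq unfolding r(3,6) norm_det2_spheres[OF r(1,4)] by auto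
    thus ?thesis by blast
  qed
  have sym: "T \<inter> S = {} \<or> tangent T S \<or> tangent S T" using assms(4) by blast
  have ?C
    using assms(1,2) unfolding spinor_of_def
  proof (elim disjE exE conjE)
    fix h a r assume "h > 0" "T = horoplane h" "w = (of_real (sqrt h), 0)" "r > 0" "S = horoball_sphere a r"
      "v = (a / of_real (sqrt (2 * r)), 1 / of_real (sqrt (2 * r)))"
    from **[OF this sym] show ?C by (auto simp: det2_swap[of v w])
  next
    fix h a r assume "h > 0" "S = horoplane h" "v = (of_real (sqrt h), 0)" "r > 0" "T = horoball_sphere a r"
      "w = (a / of_real (sqrt (2 * r)), 1 / of_real (sqrt (2 * r)))"
    from **[OF this] assms(4) show ?C by auto
  qed (rule *, assumption+, rule ***, assumption+)
  thus "norm (det2 v w) \<ge> 1 \<or>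
      (norm (fst v), norm (snd v)) \<noteq> (norm (fst w), norm (snd w)) \<and> det2 v w = 0"
    and "tangent S T \<Longrightarrow> norm (det2 v w) = 1" by blast+
qed

theorem theorem3:
  fixes P :: "(complex \<times> real) set set" and n m :: nat
  assumes "horosphere_packing P"
    and "n = card P" and "n \<ge> 5"
    and "m = num_tangencies P"
  shows "int m \<le> 5 * int n - 16"
proof -
  have P: "finite P" "\<And>S. S \<in> P \<Longrightarrow> horosphere S"
    "\<And>S T. S \<in> P \<Longrightarrow> T \<in> P \<Longrightarrow> S \<noteq> T \<Longrightarrow> S \<inter> T = {} \<or> tangent S T"
    using assms(1) by (auto simp: horosphere_packing_def)
  obtain v where v: "\<And>S. S \<in> P \<Longrightarrow> spinor_of S (v S)"
    using P(2) horosphere_spinor by metis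
  let ?E = "edges (\<lambda>S T. norm (det2 (v S) (v T)) = 1) P"
  have "card ?E + 16 \<le> 5 * card P"
  proof (rule card_edges_spinors_le)
    fix S T assume "S \<in> P" "T \<in> P" "S \<noteq> T"
    thus "norm (det2 (v S) (v T)) \<ge> 1 \<or>
      (norm (fst (v S)), norm (snd (v S))) \<noteq> (norm (fst (v T)), norm (snd (v T))) \<and> det2 (v S) (v T) = 0"
      by (intro spinor_separation(1)[of S _ T] v P(3))
  next
    fix S assume "S \<in> P"
    thus "v S \<noteq> 0" by (intro spinor_of_nonzero[of S] v)
  qed (use assms P in auto)
  \<comment> \<open>The horospheres themselves index the graph. Tangent pairs are among its edges,
    and this inclusion suffices for an upper bound.\<close>
  moreover have "num_tangencies P \<le> card ?E"
    unfolding num_tangencies_def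
  proof (rule card_mono)
    show "finite ?E" by (rule finite_subset[of _ "Pow P"]) (use P in \<open>auto simp: edges_def\<close>)
    show "{{S, T} | S T. S \<in> P \<and> T \<in> P \<and> S \<noteq> T \<and> tangent S T} \<subseteq> ?E"
      unfolding edges_def using spinor_separation(2)[OF v v _ P(3)] by blast
  qed
  ultimately show ?thesis using assms by linarith
qed

end
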